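(* Let $C$ be a closed convex cone in $\mathbb{R}^n$ with non-empty interior and not containing an entire line. The volume is strictly convex on the set of $C$-coconvex bodies. More precisely, if $K_1,K_2$ are $C$-coconvex bodies and $\lambda\in(0,1)$, then $$V_n\big((1-\lambda)K_1\oplus\lambda K_2\big)\leq(1-\lambda)V_n(K_1)+\lambda V_n(K_2).$$ Moreover, equality holds if and only if $K_1=K_2$.
   Context: Let $C\subset\mathbb{R}^n$ be a closed convex cone with non-empty interior, not containing an entire line. A $C$-coconvex body is a non-empty closed bounded proper subset $K$ of $C$ such that $C\setminus K$ is convex. For $t>0$, $tK=\{tx: x\in K\}$. For $C$-coconvex bodies $K_1,K_2$, the operation $\oplus$ is defined by $K_1\oplus K_2=C\setminus\big((C\setminus K_1)+(C\setminus K_2)\big)$, where $+$ is the Minkowski sum of sets, $A+B=\{a+b: a\in A,\ b\in B\}$. The set of $C$-coconvex bodies is stable under multiplication by positive scalars and under $\oplus$. $V_n$ denotes the volume (Lebesgue measure) in $\mathbb{R}^n$.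
   Formalization: Equality iff K_1=K_2 fails for n=1 and for bodies differing by null pieces on the boundary of C; proved for n≥2 as: equality iff K_1, K_2 agree in the interior of C, and iff K_1=K_2 when each K_i is the closure of its interior. The inequality is unrestricted. *)

theory Defs
  imports "HOL-Analysis.Analysis"
begin

definition contains_line :: "'a::real_vector set \<Rightarrow> bool"
  where "contains_line S \<longleftrightarrow> (\<exists>x v. v \<noteq> 0 \<and> (\<forall>t::real. x + t *\<^sub>R v \<in> S))"

(* Pitfall: these conditions allow K to carry extra null pieces on the frontier of C.
   For C the closed quadrant of the plane, the set {(0,0)} and the segment from
   (0,0) to (1,0) are both coconvex (of volume 0), and so are the triangle {x + y <= 1} of C
   and that triangle together with the segment from (1,0) to (2,0).
   Bodies without such pieces are exactly those with K = closure (interior K). *)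
definition coconvex_body :: "'a::euclidean_space set \<Rightarrow> 'a set \<Rightarrow> bool"
  where "coconvex_body C K \<longleftrightarrow>
    K \<noteq> {} \<and> closed K \<and> bounded K \<and> K \<subset> C \<and> convex (C - K)"

(* The + on the right-hand side is the Minkowski sum of sets. *)
definition coconvex_sum :: "'a::euclidean_space set \<Rightarrow> 'a set \<Rightarrow> 'a set \<Rightarrow> 'a set"
  where "coconvex_sum C K\<^sub>1 K\<^sub>2 = C - ((C - K\<^sub>1) + (C - K\<^sub>2))"

(* Lebesgue (not Borel) measure: a Minkowski sum of convex sets that are neither open nor
   closed is convex, hence Lebesgue measurable, but it need not be a Borel set. *)
abbreviation volume :: "'a::euclidean_space set \<Rightarrow> real"
  where "volume S \<equiv> measure lebesgue S"

end

(*
  Fix v in the interior of C. Along the lines parallel to v, the cone C and the convex sets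
  C - K1, C - K2 are (up to null sets) epigraphs of convex functions f, h1, h2 with
  f <= h1, h2, and the volume of Ki is the integral of hi - f over the directions transversal
  to v. The set (1-l)(C - K1) + l(C - K2) contains the strict epigraph of (1-l) h1 + l h2,
  which gives the inequality. In the equality case
    (1-l) h1(x) + l h2(x) <= (1-l) h1(x + l d) + l h2(x - (1-l) d)   for all x and d,
  which forces h1 - h2 to be constant. In dimension at least 2 some line parallel to v misses
  both K1 and K2, so the constant is 0.
*)
theory Submission
  imports Defs
begin

section \<open>Convex functions of slope -1 along \<open>v\<close>\<close>

text \<open>The function on the hyperplane transversal to \<open>v\<close> whose epigraph is considered is extended
  to the whole space so that its epigraph becomes \<open>{x. h x \<le> 0}\<close>.\<close>
definition height_function :: "'a::euclidean_space \<Rightarrow> ('a \<Rightarrow> real) \<Rightarrow> bool"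
  where "height_function v h \<longleftrightarrow> convex_on UNIV h \<and> (\<forall>x t. h (x + t *\<^sub>R v) = h x - t)"

lemma height_function_shift: "height_function v h \<Longrightarrow> h (x + t *\<^sub>R v) = h x - t"
  by (simp add: height_function_def)

lemma height_function_continuous: "height_function v h \<Longrightarrow> continuous_on UNIV h"
  by (simp add: height_function_def convex_on_continuous)

lemma height_function_borel: "height_function v h \<Longrightarrow> h \<in> borel_measurable borel"
  by (simp add: height_function_continuous borel_measurable_continuous_onI)

lemma height_function_combination:
  assumes "height_function v f" "height_function v g" "0 \<le> l" "l \<le> 1"
  shows "height_function v (\<lambda>x. (1 - l) * f x + l * g x)"
proof -
  have "convex_on UNIV (\<lambda>x. (1 - l) * f x + l * g x)"
    using assms by (intro convex_on_add convex_on_cmul) (auto simp: height_function_def)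
  moreover have "(1 - l) * (f x - t) + l * (g x - t) = (1 - l) * f x + l * g x - t" for x t
    by (simp add: algebra_simps)
  ultimately show ?thesis
    using assms by (simp add: height_function_def)
qed

lemma convex_on_sublevel:
  assumes "convex_on UNIV h" shows "convex {x. h x \<le> (0::real)}"
proof (rule convexI)
  fix x y and u w :: real
  assume *: "x \<in> {x. h x \<le> 0}" "y \<in> {x. h x \<le> 0}" and uw: "0 \<le> u" "0 \<le> w" "u + w = 1"
  have "h (u *\<^sub>R x + w *\<^sub>R y) \<le> u * h x + w * h y"
    using assms uw by (simp add: convex_on_def)
  also have "\<dots> \<le> 0"
    using * uw by (simp add: add_nonpos_nonpos mult_nonneg_nonpos)
  finally show "u *\<^sub>R x + w *\<^sub>R y \<in> {x. h x \<le> 0}" by simp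
qed

text \<open>The level set lies on the frontier of the convex set \<open>{x. h x \<le> 0}\<close>,
  because any step backwards along \<open>v\<close> makes \<open>h\<close> positive; frontiers of
  convex sets are negligible.\<close>

lemma negligible_zero_height:
  assumes h: "height_function v h"
  shows "negligible {x. h x = 0}"
proof -
  let ?S = "{x. h x \<le> 0}"
  have "convex ?S"
    using h convex_on_sublevel by (auto simp: height_function_def)
  moreover have "{x. h x = 0} \<subseteq> frontier ?S"
  proof safe
    fix x assume x: "h x = 0"
    have "x \<notin> interior ?S"
    proof
      assume "x \<in> interior ?S"
      then obtain e where e: "e > 0" "ball x e \<subseteq> ?S" by (auto simp: mem_interior)
      \<comment> \<open>The summand 1 keeps the divisor positive without a case distinction on
        \<open>v = 0\<close>.\<close>
      define t where "t = e / (2 * (norm v + 1))"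
      have "t > 0" using e by (simp add: t_def add_nonneg_pos)
      have "t * norm v \<le> t * (norm v + 1)" using \<open>t > 0\<close> by simp
      also have "\<dots> = e / 2"
        using norm_ge_zero[of v] by (simp add: t_def field_simps add_nonneg_eq_0_iff)
      also have "\<dots> < e" using e by simp
      finally have "x + (- t) *\<^sub>R v \<in> ball x e"
        using \<open>t > 0\<close> by (simp add: dist_norm)
      then have "h (x + (- t) *\<^sub>R v) \<le> 0" using e by blast
      then show False using height_function_shift[OF h, of x "- t"] x \<open>t > 0\<close> by simp
    qed
    then show "x \<in> frontier ?S"
      using x closure_subset by (force simp: frontier_def)
  qed
  ultimately show ?thesis
    using negligible_convex_frontier negligible_subset by blast
qed

section \<open>Volume between two height functions\<close>

text \<open>Fubini on the product of the space with the real line replaces a splitting of the space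
  along \<open>v\<close>: the slab in the integral has width 1 in the direction \<open>v\<close>.\<close>
lemma emeasure_between_heights:
  fixes v :: "'a::euclidean_space"
  assumes v: "v \<noteq> 0" and f: "height_function v f" and h: "height_function v h"
  shows "emeasure lborel {x. f x \<le> 0 \<and> 0 < h x} =
    (\<integral>\<^sup>+x. indicator {x. 0 \<le> x \<bullet> v / (v \<bullet> v) \<and> x \<bullet> v / (v \<bullet> v) < 1} x * ennreal (h x - f x) \<partial>lborel)"
proof -
  note [measurable] = height_function_borel[OF f] height_function_borel[OF h]
  define w where "w x = x \<bullet> v / (v \<bullet> v)" for x
  have [measurable]: "w \<in> borel_measurable borel" unfolding w_def by measurable
  have w: "w (x + s *\<^sub>R v) = w x + s" for x s
    using v by (simp add: w_def inner_add_left add_divide_distrib)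
  let ?S = "{x. f x \<le> 0 \<and> 0 < h x}" and ?B = "{x. 0 \<le> w x \<and> w x < 1}"
  \<comment> \<open>For \<open>x\<close> in the slab, the admissible \<open>s\<close> fill
    \<open>{f x ..< h x}\<close>; for a fixed endpoint \<open>y = x + s *\<^sub>R v\<close> in
    \<open>?S\<close> they fill an interval of length 1. The two orders of integration give the two
    sides.\<close>
  let ?F = "\<lambda>x s. indicator ?B x * indicator ?S (x + s *\<^sub>R v) :: ennreal"
  have "(\<integral>\<^sup>+x. indicator ?B x * ennreal (h x - f x) \<partial>lborel) = (\<integral>\<^sup>+x. \<integral>\<^sup>+s. ?F x s \<partial>lborel \<partial>lborel)"
  proof (rule nn_integral_cong)
    fix x :: 'a
    have "(\<integral>\<^sup>+s. ?F x s \<partial>lborel) = (\<integral>\<^sup>+s. indicator ?B x * indicator {f x ..< h x} s \<partial>lborel)"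
      by (intro nn_integral_cong)
        (auto simp: indicator_def height_function_shift[OF f] height_function_shift[OF h])
    also have "\<dots> = indicator ?B x * emeasure lborel {f x ..< h x}"
      by (simp add: nn_integral_cmult)
    also have "\<dots> = indicator ?B x * ennreal (h x - f x)"
      \<comment> \<open>If \<open>h x < f x\<close>, the interval is empty and
        \<open>ennreal\<close> truncates the difference to 0.\<close>
      by (cases "f x \<le> h x") (auto simp: ennreal_neg)
    finally show "indicator ?B x * ennreal (h x - f x) = (\<integral>\<^sup>+s. ?F x s \<partial>lborel)" ..
  qed
  also have "\<dots> = (\<integral>\<^sup>+s. \<integral>\<^sup>+x. ?F x s \<partial>lborel \<partial>lborel)"
    by (rule lborel_pair.Fubini'[symmetric]) measurable
  also have "\<dots> = (\<integral>\<^sup>+s. \<integral>\<^sup>+y. indicator ?B (y - s *\<^sub>R v) * indicator ?S y \<partial>lborel \<partial>lborel)"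
  proof (rule nn_integral_cong)
    fix s :: real
    have "(\<integral>\<^sup>+y. indicator ?B (y - s *\<^sub>R v) * indicator ?S y \<partial>lborel)
        = (\<integral>\<^sup>+y. indicator ?B (y - s *\<^sub>R v) * indicator ?S y \<partial>distr lborel borel ((+) (s *\<^sub>R v)))"
      by (simp add: lborel_distr_plus)
    also have "\<dots> = (\<integral>\<^sup>+x. ?F x s \<partial>lborel)"
      by (subst nn_integral_distr) (simp_all add: add.commute)
    finally show "(\<integral>\<^sup>+x. ?F x s \<partial>lborel)
        = (\<integral>\<^sup>+y. indicator ?B (y - s *\<^sub>R v) * indicator ?S y \<partial>lborel)" ..
  qed
  also have "\<dots> = (\<integral>\<^sup>+y. \<integral>\<^sup>+s. indicator ?B (y - s *\<^sub>R v) * indicator ?S y \<partial>lborel \<partial>lborel)"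
    by (rule lborel_pair.Fubini') measurable
  also have "\<dots> = (\<integral>\<^sup>+y. indicator ?S y \<partial>lborel)"
  proof (rule nn_integral_cong)
    fix y :: 'a
    have wm: "w (y - s *\<^sub>R v) = w y - s" for s
      using w[of y "- s"] by simp
    have "(\<integral>\<^sup>+s. indicator ?B (y - s *\<^sub>R v) * indicator ?S y \<partial>lborel)
        = (\<integral>\<^sup>+s. indicator ?S y * indicator {w y - 1 <.. w y} s \<partial>lborel)"
      by (intro nn_integral_cong) (auto simp: indicator_def wm)
    also have "\<dots> = indicator ?S y"
      by (simp add: nn_integral_cmult)
    finally show "(\<integral>\<^sup>+s. indicator ?B (y - s *\<^sub>R v) * indicator ?S y \<partial>lborel)
        = (indicator ?S y :: ennreal)" .
  qed
  also have "\<dots> = emeasure lborel ?S"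
    by simp
  finally show ?thesis by (simp add: w_def)
qed

text \<open>The slab integrand \<open>h - f\<close> is affine in \<open>h\<close>, and the bounds by
  \<open>f\<close> exclude truncation by \<open>ennreal\<close>, so the integral respects the
  weighted mean.\<close>

lemma emeasure_between_heights_combination:
  fixes v :: "'a::euclidean_space"
  assumes v: "v \<noteq> 0" and f: "height_function v f"
    and h1: "height_function v h1" "\<And>x. f x \<le> h1 x"
    and h2: "height_function v h2" "\<And>x. f x \<le> h2 x"
    and l: "0 \<le> l" "l \<le> 1"
  shows "emeasure lborel {x. f x \<le> 0 \<and> 0 < (1 - l) * h1 x + l * h2 x}
    = ennreal (1 - l) * emeasure lborel {x. f x \<le> 0 \<and> 0 < h1 x}
      + ennreal l * emeasure lborel {x. f x \<le> 0 \<and> 0 < h2 x}"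
proof -
  note [measurable] = height_function_borel[OF f] height_function_borel[OF h1(1)]
    height_function_borel[OF h2(1)]
  let ?I = "indicator {x. 0 \<le> x \<bullet> v / (v \<bullet> v) \<and> x \<bullet> v / (v \<bullet> v) < 1} :: 'a \<Rightarrow> ennreal"
  have "ennreal ((1 - l) * h1 x + l * h2 x - f x)
      = ennreal (1 - l) * ennreal (h1 x - f x) + ennreal l * ennreal (h2 x - f x)" for x
  proof -
    have "(1 - l) * h1 x + l * h2 x - f x = (1 - l) * (h1 x - f x) + l * (h2 x - f x)"
      by (simp add: algebra_simps)
    then show ?thesis
      using l h1(2)[of x] h2(2)[of x] by (simp add: ennreal_mult ennreal_plus)
  qed
  then show ?thesis
    using height_function_combination[OF f f l]
    by (simp add: emeasure_between_heights[OF v f] h1 h2 height_function_combination l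
        distrib_left mult.left_commute nn_integral_add nn_integral_cmult)
qed

section \<open>Rigidity for the equality case\<close>

text \<open>Convexity turns the hypothesis into a comparison of consecutive increments of \<open>g\<close> and \<open>f\<close>,
  which is summed over a fine subdivision of a segment.\<close>
lemma convex_rigidity:
  fixes f g :: "'a::euclidean_space \<Rightarrow> real"
  assumes f: "convex_on UNIV f" and g: "convex_on UNIV g" and l: "0 < l" "l < 1"
    and le: "\<And>x d. (1 - l) * f x + l * g x \<le> (1 - l) * f (x + l *\<^sub>R d) + l * g (x - (1 - l) *\<^sub>R d)"
  shows "f x - g x = f y - g y"
proof -
  \<comment> \<open>Convexity bounds the increments in \<open>le\<close> by the fractions
    \<open>l\<close> and \<open>1 - l\<close> of the full ones; both terms then carry the positive
    factor \<open>(1 - l) * l\<close>, which cancels.\<close>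
  have step: "g x - g (x - d) \<le> f (x + d) - f x" for x d
  proof -
    have "f ((1 - l) *\<^sub>R x + l *\<^sub>R (x + d)) \<le> (1 - l) * f x + l * f (x + d)"
      by (rule convex_onD[OF f]) (use l in auto)
    then have 1: "f (x + l *\<^sub>R d) - f x \<le> l * (f (x + d) - f x)"
      by (simp add: algebra_simps)
    have "g ((1 - (1 - l)) *\<^sub>R x + (1 - l) *\<^sub>R (x - d)) \<le> (1 - (1 - l)) * g x + (1 - l) * g (x - d)"
      by (rule convex_onD[OF g]) (use l in auto)
    then have 2: "g (x - (1 - l) *\<^sub>R d) - g x \<le> (1 - l) * (g (x - d) - g x)"
      by (simp add: algebra_simps)
    have "0 \<le> (1 - l) * (f (x + l *\<^sub>R d) - f x) + l * (g (x - (1 - l) *\<^sub>R d) - g x)"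
      using le[of x d] by (simp add: algebra_simps)
    also have "\<dots> \<le> (1 - l) * (l * (f (x + d) - f x)) + l * ((1 - l) * (g (x - d) - g x))"
      by (intro add_mono mult_left_mono 1 2) (use l in auto)
    also have "\<dots> = ((1 - l) * l) * ((f (x + d) - f x) - (g x - g (x - d)))"
      by (simp add: algebra_simps)
    finally show ?thesis
      using l mult_pos_pos[of "1 - l" l] by (auto simp: zero_le_mult_iff not_le[symmetric])
  qed
  have telescope: "g (x + real n *\<^sub>R d - d) - g (x - d) \<le> f (x + real n *\<^sub>R d) - f x" for x d n
  proof (induction n)
    case (Suc n)
    then show ?case
      using step[of "x + real n *\<^sub>R d" d] by (simp add: algebra_simps)
  qed simp
  \<comment> \<open>In \<open>telescope\<close>, \<open>g\<close> lags one step behind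
    \<open>f\<close>. With \<open>Suc n\<close> steps from \<open>x\<close> to \<open>y\<close> the
    lag tends to 0, and continuity of \<open>g\<close> removes it.\<close>
  have limit: "g y - g x \<le> f y - f x" for x y
  proof (rule tendsto_upperbound)
    let ?d = "\<lambda>n. inverse (real (Suc n)) *\<^sub>R (y - x)"
    have d: "?d \<longlonglongrightarrow> 0 *\<^sub>R (y - x)"
      by (intro tendsto_intros LIMSEQ_inverse_real_of_nat)
    have "isCont g z" for z
      using convex_on_continuous[OF open_UNIV g] by (simp add: continuous_on_eq_continuous_at)
    then show "(\<lambda>n. g (y - ?d n) - g (x - ?d n)) \<longlonglongrightarrow> g y - g x"
      using tendsto_diff[OF tendsto_const[of y] d] tendsto_diff[OF tendsto_const[of x] d]
      by (intro tendsto_diff isCont_tendsto_compose[where g = g]) simp_all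
    show "\<forall>\<^sub>F n in sequentially. g (y - ?d n) - g (x - ?d n) \<le> f y - f x"
    proof (intro always_eventually allI)
      fix n
      have "real (Suc n) *\<^sub>R ?d n = y - x" by (simp del: of_nat_Suc)
      then show "g (y - ?d n) - g (x - ?d n) \<le> f y - f x"
        using telescope[of x "Suc n" "?d n"] by (simp del: of_nat_Suc)
    qed
  qed simp
  show ?thesis using limit[of x y] limit[of y x] by linarith
qed

section \<open>Heights of upward closed subsets of the cone\<close>

locale cone_direction =
  fixes C :: "'a::euclidean_space set" and v :: 'a
  assumes closed_C: "closed C" and cone_C: "convex_cone C"
    and v_interior: "v \<in> interior C" and uminus_v: "- v \<notin> C"
begin

text \<open>For an \<open>upset\<close> this is a genuine infimum: \<open>line_meets\<close> and
  \<open>line_bdd_below\<close> make the set non-empty and bounded below.\<close>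

definition height :: "'a set \<Rightarrow> 'a \<Rightarrow> real"
  where "height A x = Inf {s. x + s *\<^sub>R v \<in> A}"

text \<open>Covers both \<open>C\<close> and the complements \<open>C - K\<close>; the latter need
  not be closed, so closedness is not demanded.\<close>

definition upset :: "'a set \<Rightarrow> bool"
  where "upset A \<longleftrightarrow> A \<subseteq> C \<and> A \<noteq> {} \<and> convex A \<and> (\<forall>a\<in>A. \<forall>c\<in>C. a + c \<in> A)"

lemma v_in: "v \<in> C"
  using v_interior interior_subset by blast

lemma v_nonzero: "v \<noteq> 0"
  using uminus_v v_in by auto

text \<open>For large \<open>s\<close> the point \<open>v + inverse s *\<^sub>R x\<close> is still
  near the interior point \<open>v\<close>; scaling it by \<open>s\<close> stays in the
  cone.\<close>

lemma line_meets_cone: "\<exists>s. x + s *\<^sub>R v \<in> C"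
proof -
  obtain e where e: "e > 0" "ball v e \<subseteq> C"
    using v_interior by (auto simp: mem_interior)
  define s where "s = (norm x + 1) / e"
  have s: "s > 0" using e by (simp add: s_def add_nonneg_pos)
  have "norm x < s * e" using e by (simp add: s_def)
  then have "v + inverse s *\<^sub>R x \<in> ball v e"
    using s by (simp add: dist_norm field_simps)
  then have "s *\<^sub>R (v + inverse s *\<^sub>R x) \<in> C"
    using e s convex_cone_scaleR[OF cone_C] by (meson less_imp_le subsetD)
  then show ?thesis
    using s by (auto simp: algebra_simps)
qed

lemma upset_cone: "upset C"
  using cone_C by (auto simp: upset_def convex_cone_def convex_cone_add)

lemma upset_up: "upset A \<Longrightarrow> x + s *\<^sub>R v \<in> A \<Longrightarrow> s \<le> t \<Longrightarrow> x + t *\<^sub>R v \<in> A"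
proof -
  assume A: "upset A" "x + s *\<^sub>R v \<in> A" "s \<le> t"
  have "(x + s *\<^sub>R v) + (t - s) *\<^sub>R v \<in> A"
    using A convex_cone_scaleR[OF cone_C _ v_in, of "t - s"] unfolding upset_def by simp
  then show ?thesis by (simp add: algebra_simps)
qed

text \<open>Otherwise \<open>C\<close> contains a whole line parallel to \<open>v\<close>; points
  far down on it, scaled back, converge to \<open>- v\<close>, which closedness would put into
  \<open>C\<close>.\<close>

lemma line_bdd_below: "upset A \<Longrightarrow> bdd_below {s. x + s *\<^sub>R v \<in> A}"
proof -
  assume A: "upset A"
  have "\<exists>b. \<forall>s. x + s *\<^sub>R v \<in> C \<longrightarrow> b \<le> s"
  proof (rule ccontr)
    assume "\<not> ?thesis"
    then have all: "x + s *\<^sub>R v \<in> C" for s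
      using upset_up[OF upset_cone] by (meson less_imp_le not_le)
    have "inverse (real (Suc n)) *\<^sub>R x - v \<in> C" for n
      using convex_cone_scaleR[OF cone_C _ all[of "- real (Suc n)"], of "inverse (real (Suc n))"]
      by (simp add: algebra_simps del: of_nat_Suc)
    moreover have "(\<lambda>n. inverse (real (Suc n)) *\<^sub>R x - v) \<longlonglongrightarrow> 0 *\<^sub>R x - v"
      by (intro tendsto_intros LIMSEQ_inverse_real_of_nat)
    ultimately have "- v \<in> C"
      using closed_sequentially[OF closed_C] by fastforce
    then show False using uminus_v by simp
  qed
  then show ?thesis
    using A unfolding upset_def bdd_below_def by blast
qed

lemma line_meets: "upset A \<Longrightarrow> \<exists>s. x + s *\<^sub>R v \<in> A"
proof -
  assume A: "upset A"
  then obtain a where a: "a \<in> A" by (auto simp: upset_def)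
  obtain s where "(x - a) + s *\<^sub>R v \<in> C" using line_meets_cone by blast
  then have "a + ((x - a) + s *\<^sub>R v) \<in> A" using A a unfolding upset_def by blast
  then show ?thesis by (auto simp: add.assoc[symmetric])
qed

lemma height_le: "upset A \<Longrightarrow> x + s *\<^sub>R v \<in> A \<Longrightarrow> height A x \<le> s"
  unfolding height_def by (intro cInf_lower line_bdd_below) auto

text \<open>The infimum may not be attained, so this converse of \<open>height_le\<close> is
  strict.\<close>

lemma height_less: "upset A \<Longrightarrow> height A x < s \<Longrightarrow> x + s *\<^sub>R v \<in> A"
  using cInf_lessD[of "{s. x + s *\<^sub>R v \<in> A}" s] line_meets[of A x] upset_up[of A x _ s]
  by (force simp: height_def)

lemma height_le_zero: "upset A \<Longrightarrow> x \<in> A \<Longrightarrow> height A x \<le> 0"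
  using height_le[of A x 0] by simp

lemma height_less_zero: "upset A \<Longrightarrow> height A x < 0 \<Longrightarrow> x \<in> A"
  using height_less[of A x 0] by simp

lemma height_function_height:
  assumes A: "upset A" shows "height_function v (height A)"
proof -
  have shift_le: "height A (x + t *\<^sub>R v) \<le> height A x - t" for x t
  proof (rule dense_ge)
    fix s assume "height A x - t < s"
    then have "x + (s + t) *\<^sub>R v \<in> A" by (intro height_less[OF A]) simp
    then show "height A (x + t *\<^sub>R v) \<le> s"
      by (intro height_le[OF A]) (simp add: algebra_simps)
  qed
  have "height A (x + t *\<^sub>R v) = height A x - t" for x t
    using shift_le[of x t] shift_le[of "x + t *\<^sub>R v" "- t"] by simp
  moreover have "convex_on UNIV (height A)"
  proof (rule convex_onI)
    fix t :: real and x y assume t: "0 < t" "t < 1"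
    show "height A ((1 - t) *\<^sub>R x + t *\<^sub>R y) \<le> (1 - t) * height A x + t * height A y"
    proof (rule field_le_epsilon)
      fix e :: real assume e: "e > 0"
      have "x + (height A x + e) *\<^sub>R v \<in> A" "y + (height A y + e) *\<^sub>R v \<in> A"
        using e by (auto intro!: height_less[OF A])
      then have "(1 - t) *\<^sub>R (x + (height A x + e) *\<^sub>R v) + t *\<^sub>R (y + (height A y + e) *\<^sub>R v) \<in> A"
        using A t by (auto simp: upset_def intro!: convexD)
      then have "((1 - t) *\<^sub>R x + t *\<^sub>R y)
          + ((1 - t) * height A x + t * height A y + e) *\<^sub>R v \<in> A"
        by (simp add: algebra_simps)
      then show "height A ((1 - t) *\<^sub>R x + t *\<^sub>R y)
          \<le> (1 - t) * height A x + t * height A y + e"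
        by (rule height_le[OF A])
    qed
  qed simp
  ultimately show ?thesis by (simp add: height_function_def)
qed

lemmas height_shift = height_function_shift[OF height_function_height]

text \<open>An interior point can be lowered along \<open>v\<close> within \<open>A\<close>;
  conversely the negative set of the continuous height is open and lies in \<open>A\<close>.\<close>

lemma interior_upset:
  assumes A: "upset A" shows "interior A = {x. height A x < 0}"
proof
  show "interior A \<subseteq> {x. height A x < 0}"
  proof safe
    fix x assume "x \<in> interior A"
    then obtain e where e: "e > 0" "ball x e \<subseteq> A" by (auto simp: mem_interior)
    define t where "t = e / (2 * norm v)"
    have t: "t > 0" using e v_nonzero by (simp add: t_def)
    have "x + (- t) *\<^sub>R v \<in> ball x e"
      using e v_nonzero by (simp add: dist_norm t_def)
    then have "height A x \<le> - t" using e by (intro height_le[OF A]) auto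
    then show "height A x < 0" using t by simp
  qed
  have "open {x. height A x < 0}"
    using height_function_continuous[OF height_function_height[OF A]]
    by (intro open_Collect_less continuous_intros)
  then show "{x. height A x < 0} \<subseteq> interior A"
    using height_less_zero[OF A] by (intro interior_maximal) auto
qed

lemma height_cone_le: "upset A \<Longrightarrow> height C x \<le> height A x"
  by (rule dense_ge) (metis height_le height_less subsetD upset_cone upset_def)

text \<open>Closedness of \<open>C\<close> makes the infimum attained, so the cone is exactly a
  sublevel set.\<close>

lemma height_cone_le_zero: "height C x \<le> 0 \<longleftrightarrow> x \<in> C"
proof
  assume le: "height C x \<le> 0"
  have "x + inverse (real (Suc n)) *\<^sub>R v \<in> C" for n
    by (rule height_less[OF upset_cone]) (rule le_less_trans[OF le], simp)
  moreover have "(\<lambda>n. x + inverse (real (Suc n)) *\<^sub>R v) \<longlonglongrightarrow> x + 0 *\<^sub>R v"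
    by (intro tendsto_intros LIMSEQ_inverse_real_of_nat)
  ultimately show "x \<in> C"
    using closed_sequentially[OF closed_C] by fastforce
qed (rule height_le_zero[OF upset_cone])

section \<open>Coconvex bodies and the heights of their complements\<close>

text \<open>The ray from \<open>a\<close> in direction \<open>c\<close> leaves the bounded set \<open>K\<close>, so \<open>a + c\<close> lies on a
  segment between two points of \<open>C - K\<close>.\<close>
lemma upset_complement:
  assumes K: "coconvex_body C K" shows "upset (C - K)"
proof -
  have "a + c \<in> C - K" if a: "a \<in> C - K" and c: "c \<in> C" for a c
  proof (cases "c = 0")
    case False
    obtain B where B: "\<And>x. x \<in> K \<Longrightarrow> norm x \<le> B"
      using K by (auto simp: coconvex_body_def bounded_iff)
    \<comment> \<open>Large enough that \<open>t *\<^sub>R c\<close> carries \<open>a\<close> out of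
      the ball containing \<open>K\<close>, and at least 1 so that \<open>a + c\<close> is on the
      segment to \<open>a + t *\<^sub>R c\<close>.\<close>
    define t where "t = 1 + (\<bar>B\<bar> + norm a) / norm c"
    have t: "1 \<le> t" by (simp add: t_def)
    have "t * norm c = norm c + \<bar>B\<bar> + norm a"
      using False by (simp add: t_def field_simps)
    then have "B + norm a < norm (t *\<^sub>R c)"
    proof -
      have "0 < norm c" "B \<le> \<bar>B\<bar>" "norm (t *\<^sub>R c) = t * norm c" using False t by auto
      then show ?thesis using \<open>t * norm c = norm c + \<bar>B\<bar> + norm a\<close> by linarith
    qed
    also have "\<dots> \<le> norm (a + t *\<^sub>R c) + norm a"
      using norm_triangle_ineq4[of "a + t *\<^sub>R c" a] by simp
    finally have "a + t *\<^sub>R c \<notin> K" using B by fastforce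
    moreover have "a + t *\<^sub>R c \<in> C"
      using a c t convex_cone_add[OF cone_C] convex_cone_scaleR[OF cone_C] by simp
    ultimately have *: "a + t *\<^sub>R c \<in> C - K" by simp
    have "(1 - inverse t) *\<^sub>R a + inverse t *\<^sub>R (a + t *\<^sub>R c) \<in> C - K"
      by (rule convexD)
        (use K a * t in \<open>auto simp: coconvex_body_def inverse_le_1_iff\<close>)
    then show ?thesis using t by (simp add: algebra_simps)
  qed (use a in simp)
  then show ?thesis
    using K by (auto simp: upset_def coconvex_body_def)
qed

abbreviation depth :: "'a set \<Rightarrow> 'a \<Rightarrow> real"
  where "depth K \<equiv> height (C - K)"

lemma height_function_depth: "coconvex_body C K \<Longrightarrow> height_function v (depth K)"
  by (simp add: height_function_height upset_complement)

lemma between_subset_body: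
  "coconvex_body C K \<Longrightarrow> {x. height C x \<le> 0 \<and> 0 < depth K x} \<subseteq> K"
  using height_le_zero[OF upset_complement, of K] height_cone_le_zero by force

lemma between_lebesgue:
  assumes "height_function v h"
  shows "{x. height C x \<le> 0 \<and> 0 < h x} \<in> sets borel"
proof -
  note [measurable] = height_function_borel[OF assms]
    height_function_borel[OF height_function_height[OF upset_cone]]
  show ?thesis by measurable
qed

text \<open>The body and the region between the two heights differ only where \<open>depth K\<close>
  vanishes: negative depth means membership in \<open>C - K\<close>, and positive depth excludes
  it.\<close>

lemma body_volume:
  assumes K: "coconvex_body C K"
  shows "emeasure lborel {x. height C x \<le> 0 \<and> 0 < depth K x} = ennreal (volume K)"
proof -
  let ?D = "{x. height C x \<le> 0 \<and> 0 < depth K x}"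
  have "compact K" using K by (auto simp: coconvex_body_def compact_eq_bounded_closed)
  then have Km: "K \<in> lmeasurable" by (rule lmeasurable_compact)
  have "K - ?D \<union> (?D - K) \<subseteq> {x. depth K x = 0}"
    using between_subset_body[OF K] height_less_zero[OF upset_complement[OF K]] K
      height_cone_le_zero
    by (force simp: coconvex_body_def not_less le_less)
  then have neg: "negligible (K - ?D \<union> (?D - K))"
    using negligible_zero_height[OF height_function_depth[OF K]] negligible_subset by blast
  have "?D \<in> lmeasurable" "measure lebesgue ?D = volume K"
    using lmeasurable_negligible_symdiff[OF Km neg] measure_negligible_symdiff[OF Km neg] by auto
  then have "emeasure lebesgue ?D = ennreal (volume K)"
    by (simp add: emeasure_eq_measure2)
  then show ?thesis
    using between_lebesgue[OF height_function_depth[OF K]] by simp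
qed

lemma scaled_complement:
  assumes "0 < c" shows "C - (*\<^sub>R) c ` K = (*\<^sub>R) c ` (C - K)"
proof -
  have "(*\<^sub>R) c ` C = C"
  proof
    show "(*\<^sub>R) c ` C \<subseteq> C" using assms convex_cone_scaleR[OF cone_C] by auto
    show "C \<subseteq> (*\<^sub>R) c ` C"
    proof
      fix x assume "x \<in> C"
      then have "inverse c *\<^sub>R x \<in> C" using assms convex_cone_scaleR[OF cone_C] by simp
      then show "x \<in> (*\<^sub>R) c ` C" using assms by (intro image_eqI[of _ _ "inverse c *\<^sub>R x"]) auto
    qed
  qed
  moreover have "inj ((*\<^sub>R) c :: 'a \<Rightarrow> 'a)" using assms by (simp add: inj_on_def)
  ultimately show ?thesis by (simp add: image_set_diff)
qed

text \<open>As \<open>M\<close> is closed, \<open>interior C - M\<close> is the interior of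
  \<open>C - M\<close>, hence the negative set of \<open>depth M\<close>; sliding along
  \<open>v\<close> recovers the whole function from this set.\<close>

lemma depth_eq_iff:
  assumes K: "coconvex_body C K" and L: "coconvex_body C L"
  shows "depth K = depth L \<longleftrightarrow> K \<inter> interior C = L \<inter> interior C"
proof -
  have int: "interior C - M = {x. depth M x < 0}" if "coconvex_body C M" for M
    using that interior_upset[OF upset_complement[OF that]]
    by (simp add: interior_diff coconvex_body_def)
  have "depth K = depth L" if "{x. depth K x < 0} = {x. depth L x < 0}"
  proof
    fix x
    have "depth K x < s \<longleftrightarrow> depth L x < s" for s
    proof -
      have "depth K (x + s *\<^sub>R v) < 0 \<longleftrightarrow> depth L (x + s *\<^sub>R v) < 0" using that by blast
      then show ?thesis by (simp add: height_shift upset_complement K L)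
    qed
    then show "depth K x = depth L x" by (metis less_irrefl linorder_neqE)
  qed
  then have "depth K = depth L \<longleftrightarrow> interior C - K = interior C - L"
    using int[OF K] int[OF L] by auto
  also have "\<dots> \<longleftrightarrow> K \<inter> interior C = L \<inter> interior C" by blast
  finally show ?thesis .
qed

text \<open>A line parallel to \<open>v\<close> and far out in an orthogonal direction misses both
  bodies, so both depths equal the height of the cone there. On a half-line no such line
  exists.\<close>

lemma depths_agree_somewhere:
  assumes K: "coconvex_body C K" and L: "coconvex_body C L" and dim: "2 \<le> DIM('a)"
  obtains y where "depth K y = depth L y"
proof -
  obtain d where d: "d \<noteq> 0" "orthogonal v d"
    using orthogonal_to_vector_exists[OF dim] by blast
  have "bounded (K \<union> L)" using K L by (auto simp: coconvex_body_def)
  then obtain B where B: "\<And>x. x \<in> K \<union> L \<Longrightarrow> norm x \<le> B" by (auto simp: bounded_iff)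
  \<comment> \<open>Gives every point of the line a component of length
    \<open>\<bar>B\<bar> + 1\<close> along \<open>d\<close>.\<close>
  define t where "t = (\<bar>B\<bar> + 1) / norm d"
  have "depth M (t *\<^sub>R d) = height C (t *\<^sub>R d)" if M: "M = K \<or> M = L" for M
  proof (rule ccontr)
    assume ne: "depth M (t *\<^sub>R d) \<noteq> height C (t *\<^sub>R d)"
    have body: "coconvex_body C M" using M K L by blast
    \<comment> \<open>The point where the line enters the cone; a larger depth would put it into
      \<open>M\<close>.\<close>
    define z where "z = t *\<^sub>R d + height C (t *\<^sub>R d) *\<^sub>R v"
    have "height C z \<le> 0" "0 < depth M z"
      using ne height_cone_le[OF upset_complement[OF body], of "t *\<^sub>R d"]
      by (auto simp: z_def height_shift upset_cone upset_complement body)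
    then have "z \<in> M" using between_subset_body[OF body] by blast
    then have "norm z \<le> B" using B M by blast
    moreover have "norm z * norm d \<ge> (\<bar>B\<bar> + 1) * norm d"
    proof -
      have "z \<bullet> d = t * (d \<bullet> d)"
        using d by (simp add: z_def inner_add_left orthogonal_def)
      also have "\<dots> = (\<bar>B\<bar> + 1) * norm d"
        using d by (simp add: t_def dot_square_norm power2_eq_square)
      finally show ?thesis using norm_cauchy_schwarz[of z d] by simp
    qed
    ultimately show False using d by simp
  qed
  then show thesis using that by metis
qed

section \<open>The weighted sum of two bodies: volume inequality and equality case\<close>

context
  fixes K L :: "'a set" and l :: real
  assumes K: "coconvex_body C K" and L: "coconvex_body C L" and l: "0 < l" "l < 1"
begin

definition "mean_height x = (1 - l) * depth K x + l * depth L x"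

definition "sum_complement = (*\<^sub>R) (1 - l) ` (C - K) + (*\<^sub>R) l ` (C - L)"

definition "mean_volume = (1 - l) * volume K + l * volume L"

text \<open>The comparison region: its volume is exactly the weighted mean of the two
  volumes.\<close>

definition "between_region = {x. height C x \<le> 0 \<and> 0 < mean_height x}"

lemma coconvex_sum_eq:
  "coconvex_sum C ((*\<^sub>R) (1 - l) ` K) ((*\<^sub>R) l ` L) = C - sum_complement"
  using l by (simp add: coconvex_sum_def scaled_complement sum_complement_def)

lemma sum_complementI:
  "a \<in> C - K \<Longrightarrow> b \<in> C - L \<Longrightarrow> (1 - l) *\<^sub>R a + l *\<^sub>R b \<in> sum_complement"
  unfolding sum_complement_def by (intro set_plus_intro imageI)

lemma sum_complementE:
  assumes "x \<in> sum_complement"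
  obtains a b where "a \<in> C - K" "b \<in> C - L" "x = (1 - l) *\<^sub>R a + l *\<^sub>R b"
  using assms unfolding sum_complement_def by (auto elim!: set_plus_elim)

lemma height_function_mean: "height_function v mean_height"
  using height_function_combination[OF height_function_depth[OF K] height_function_depth[OF L]] l
  by (simp add: mean_height_def[abs_def])

lemma mean_height_less_zero: "mean_height x < 0 \<Longrightarrow> x \<in> sum_complement"
proof -
  assume neg: "mean_height x < 0"
  \<comment> \<open>The shifts \<open>s\<close> and \<open>t\<close> exceed the depths by the
    positive number \<open>- mean_height x\<close>, and their weighted mean is 0, so they cancel in
    the sum.\<close>
  define s where "s = depth K x - mean_height x"
  define t where "t = depth L x - mean_height x"
  have "x + s *\<^sub>R v \<in> C - K" "x + t *\<^sub>R v \<in> C - L"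
    using neg height_less[OF upset_complement[OF K]] height_less[OF upset_complement[OF L]]
    by (simp_all add: s_def t_def)
  then have "(1 - l) *\<^sub>R (x + s *\<^sub>R v) + l *\<^sub>R (x + t *\<^sub>R v) \<in> sum_complement"
    by (rule sum_complementI)
  moreover have "(1 - l) *\<^sub>R (x + s *\<^sub>R v) + l *\<^sub>R (x + t *\<^sub>R v) = x + ((1 - l) * s + l * t) *\<^sub>R v"
    by (simp add: algebra_simps)
  moreover have "(1 - l) * s + l * t = 0"
    by (simp add: s_def t_def mean_height_def algebra_simps)
  ultimately show ?thesis by simp
qed

lemma between_region:
  shows "between_region \<in> lmeasurable" and "measure lebesgue between_region = mean_volume"
proof -
  have nonneg: "0 \<le> mean_volume" using l by (simp add: mean_volume_def)
  have "emeasure lborel between_region = ennreal mean_volume"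
    using l emeasure_between_heights_combination[OF v_nonzero height_function_height[OF upset_cone]
        height_function_depth[OF K] height_cone_le[OF upset_complement[OF K]]
        height_function_depth[OF L] height_cone_le[OF upset_complement[OF L]], of l]
    by (simp add: between_region_def mean_height_def mean_volume_def body_volume K L
        ennreal_mult ennreal_plus)
  moreover have borel: "between_region \<in> sets borel"
    unfolding between_region_def by (rule between_lebesgue[OF height_function_mean])
  ultimately have em: "emeasure lebesgue between_region = ennreal mean_volume" by simp
  then show "between_region \<in> lmeasurable"
    using borel by (intro fmeasurableI) auto
  show "measure lebesgue between_region = mean_volume"
    using em nonneg by (simp add: measure_def)
qed

text \<open>A convex set differs from its open interior by a part of its negligible
  frontier.\<close>

lemma sum_complement_lebesgue: "sum_complement \<in> sets lebesgue"
proof -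
  have "convex sum_complement"
    using K L unfolding sum_complement_def coconvex_body_def
    by (intro convex_set_plus convex_scaling) auto
  then have "negligible (sum_complement - interior sum_complement)"
    using negligible_subset[OF negligible_convex_frontier] closure_subset[of sum_complement]
    unfolding frontier_def by (metis Diff_mono order_refl)
  then have "interior sum_complement \<union> (sum_complement - interior sum_complement) \<in> sets lebesgue"
    using negligible_imp_sets by (intro sets.Un) auto
  then show ?thesis
    using interior_subset[of sum_complement] by (simp add: Un_absorb1)
qed

lemma coconvex_sum_lebesgue: "C - sum_complement \<in> sets lebesgue"
  using sum_complement_lebesgue closed_C by (intro sets.Diff) auto

text \<open>The sum body may contain points of the null set \<open>mean_height x = 0\<close>; adding
  this set gives a superset of unchanged volume.\<close>

lemma between_closure:
  shows "between_region \<union> {x. mean_height x = 0} \<in> lmeasurable"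
    and "measure lebesgue (between_region \<union> {x. mean_height x = 0}) = mean_volume"
proof -
  have neg: "negligible (between_region - (between_region \<union> {x. mean_height x = 0})
      \<union> (between_region \<union> {x. mean_height x = 0} - between_region))"
    by (rule negligible_subset[OF negligible_zero_height[OF height_function_mean]]) auto
  show "between_region \<union> {x. mean_height x = 0} \<in> lmeasurable"
    by (rule lmeasurable_negligible_symdiff[OF between_region(1) neg])
  show "measure lebesgue (between_region \<union> {x. mean_height x = 0}) = mean_volume"
    using measure_negligible_symdiff[OF between_region(1) neg] between_region(2) by simp
qed

lemma coconvex_sum_subset: "C - sum_complement \<subseteq> between_region \<union> {x. mean_height x = 0}"
proof
  fix x assume "x \<in> C - sum_complement"
  then have "height C x \<le> 0" "\<not> mean_height x < 0"
    using mean_height_less_zero by (auto simp: height_cone_le_zero)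
  then show "x \<in> between_region \<union> {x. mean_height x = 0}"
    by (auto simp: between_region_def)
qed

lemma volume_sum_le: "volume (C - sum_complement) \<le> mean_volume"
  using measure_mono_fmeasurable[OF coconvex_sum_subset coconvex_sum_lebesgue between_closure(1)]
  by (simp add: between_closure)

text \<open>Both complements lie in the convex set \<open>depth K x \<le> 0\<close>, hence so does
  their weighted sum, which therefore misses \<open>between_region\<close>.\<close>

lemma volume_sum_eq_if:
  assumes eq: "depth K = depth L"
  shows "volume (C - sum_complement) = mean_volume"
proof (rule antisym[OF volume_sum_le])
  have mean: "mean_height x = depth K x" for x
    by (simp add: mean_height_def eq algebra_simps)
  have "mean_height x \<le> 0" if x: "x \<in> sum_complement" for x
  proof -
    obtain a b where ab: "a \<in> C - K" "b \<in> C - L" "x = (1 - l) *\<^sub>R a + l *\<^sub>R b"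
      by (rule sum_complementE[OF x])
    have "convex {x. depth K x \<le> 0}"
      using convex_on_sublevel height_function_depth[OF K] by (auto simp: height_function_def)
    moreover have "depth K a \<le> 0" "depth K b \<le> 0"
      using ab height_le_zero[OF upset_complement[OF K]] height_le_zero[OF upset_complement[OF L]]
      by (auto simp: eq)
    ultimately have "x \<in> {x. depth K x \<le> 0}"
      using l unfolding ab by (intro convexD) auto
    then show ?thesis by (simp add: mean)
  qed
  then have "between_region \<subseteq> C - sum_complement"
    by (force simp: between_region_def height_cone_le_zero)
  then have "measure lebesgue between_region \<le> volume (C - sum_complement)"
    using fmeasurableD[OF between_region(1)]
      fmeasurableI2[OF between_closure(1) coconvex_sum_subset coconvex_sum_lebesgue]
    by (rule measure_mono_fmeasurable)
  then show "mean_volume \<le> volume (C - sum_complement)"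
    by (simp add: between_region(2))
qed

text \<open>If the inequality fails, then the sum of the complements contains a non-empty open set on
  which \<open>mean_height\<close> is positive.\<close>
lemma volume_sum_eq_imp:
  assumes eq: "volume (C - sum_complement) = mean_volume"
  shows "mean_height x \<le> (1 - l) * depth K (x + l *\<^sub>R d) + l * depth L (x - (1 - l) *\<^sub>R d)"
proof (rule ccontr)
  let ?T = "between_region \<union> {x. mean_height x = 0}"
  let ?f = "depth K" and ?g = "depth L"
  \<comment> \<open>The points \<open>a\<close> and \<open>b\<close> have weighted mean
    \<open>x\<close>.\<close>
  define a where "a = x + l *\<^sub>R d"
  define b where "b = x - (1 - l) *\<^sub>R d"
  define m where "m = (1 - l) * ?f a + l * ?g b"
  assume "\<not> ?thesis"
  then have less: "m < mean_height x" by (simp add: m_def a_def b_def)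
  define e where "e = (mean_height x - m) / 2"
  have e: "0 < e" "m + e < mean_height x" using less by (auto simp: e_def field_simps)
  \<comment> \<open>Translation by \<open>p\<close> or \<open>q\<close> takes \<open>z\<close> to
    the point \<open>e\<close> above the graph of \<open>?f\<close> over \<open>a\<close> or of
    \<open>?g\<close> over \<open>b\<close>. Their weighted mean is 0, so every \<open>y\<close> is
    the weighted mean of \<open>y + p\<close> and \<open>y + q\<close>.\<close>
  define p where "p = l *\<^sub>R d + ((?f a + e) - (m + e)) *\<^sub>R v"
  define q where "q = - ((1 - l) *\<^sub>R d) + ((?g b + e) - (m + e)) *\<^sub>R v"
  define z where "z = x + (m + e) *\<^sub>R v"
  have "(1 - l) *\<^sub>R p + l *\<^sub>R q = ((1 - l) * (?f a - m) + l * (?g b - m)) *\<^sub>R v"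
    by (simp add: p_def q_def algebra_simps)
  also have "(1 - l) * (?f a - m) + l * (?g b - m) = 0"
    by (simp add: m_def algebra_simps)
  finally have pq: "(1 - l) *\<^sub>R p + l *\<^sub>R q = 0" by simp
  define U where "U = {y. ?f (y + p) < 0} \<inter> {y. ?g (y + q) < 0} \<inter> {y. 0 < mean_height y}"
  have zp: "z + p = a + (?f a + e) *\<^sub>R v" and zq: "z + q = b + (?g b + e) *\<^sub>R v"
    by (simp_all add: z_def p_def q_def a_def b_def algebra_simps)
  have "mean_height z = mean_height x - (m + e)"
    unfolding z_def by (rule height_function_shift[OF height_function_mean])
  then have "z \<in> U"
    using e by (simp add: U_def zp zq height_shift upset_complement K L)
  have cont: "continuous_on UNIV (\<lambda>y. h (y + c))" if "height_function v h" for h c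
    by (rule continuous_on_compose2[OF height_function_continuous[OF that]])
      (auto intro!: continuous_intros)
  have "open U"
    unfolding U_def
    using cont[OF height_function_depth[OF K], of p] cont[OF height_function_depth[OF L], of q]
      height_function_continuous[OF height_function_mean]
    by (intro open_Int open_Collect_less continuous_on_const)
  have "U \<subseteq> ?T - (C - sum_complement)"
  proof
    fix y assume y: "y \<in> U"
    have yp: "y + p \<in> C - K" and yq: "y + q \<in> C - L"
      using y height_less_zero[OF upset_complement[OF K]] height_less_zero[OF upset_complement[OF L]]
      by (auto simp: U_def)
    have "(1 - l) *\<^sub>R (y + p) + l *\<^sub>R (y + q) = y + ((1 - l) *\<^sub>R p + l *\<^sub>R q)"
      by (simp add: algebra_simps)
    then have y_eq: "(1 - l) *\<^sub>R (y + p) + l *\<^sub>R (y + q) = y" by (simp add: pq)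
    have "y \<in> sum_complement"
      using sum_complementI[OF yp yq] by (simp only: y_eq)
    moreover have "y \<in> C"
      using convexD[of C "y + p" "y + q" "1 - l" l] yp yq l cone_C
      by (simp add: y_eq convex_cone_def)
    ultimately show "y \<in> ?T - (C - sum_complement)"
      using y by (simp add: U_def between_region_def height_cone_le_zero)
  qed
  \<comment> \<open>Equal volumes leave only a null set between the sum body and its superset
    \<open>?T\<close>.\<close>
  moreover have "negligible (?T - (C - sum_complement))"
  proof -
    have S: "C - sum_complement \<in> lmeasurable"
      using fmeasurableI2[OF between_closure(1) coconvex_sum_subset coconvex_sum_lebesgue] .
    have "measure lebesgue (?T - (C - sum_complement)) = 0"
      using measurable_measure_Diff[OF between_closure(1) coconvex_sum_lebesgue coconvex_sum_subset]
      by (simp add: between_closure eq)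
    then show ?thesis
      using negligible_iff_measure0 fmeasurable.Diff[OF between_closure(1) S] by blast
  qed
  ultimately have "negligible U" using negligible_subset by blast
  then show False using open_not_negligible \<open>open U\<close> \<open>z \<in> U\<close> by blast
qed

text \<open>Rigidity makes the difference of the depths constant; one common value makes it
  0.\<close>

lemma volume_sum_eq_iff:
  assumes dim: "2 \<le> DIM('a)"
  shows "volume (C - sum_complement) = mean_volume \<longleftrightarrow> depth K = depth L"
proof
  assume eq: "volume (C - sum_complement) = mean_volume"
  obtain y where y: "depth K y = depth L y"
    using depths_agree_somewhere[OF K L dim] .
  have "depth K x - depth L x = depth K y - depth L y" for x
    using height_function_depth[OF K] height_function_depth[OF L] l volume_sum_eq_imp[OF eq]
    by (intro convex_rigidity[where l = l]) (auto simp: height_function_def mean_height_def)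
  then show "depth K = depth L" using y by auto
qed (rule volume_sum_eq_if)

end

end

section \<open>Regular bodies and the final statement\<close>

text \<open>Since \<open>interior K\<close> lies in \<open>interior C\<close>, a regular body is
  recovered by closure from its part there.\<close>

lemma regular_body_subset:
  assumes "closure (interior K) = K" "closed L" "K \<subseteq> C" "K \<inter> interior C \<subseteq> L"
  shows "K \<subseteq> L"
proof -
  have "interior K \<subseteq> K \<inter> interior C"
    using interior_mono[OF assms(3)] interior_subset by blast
  then have "interior K \<subseteq> L" using assms(4) by (rule subset_trans)
  then have "closure (interior K) \<subseteq> L" using assms(2) by (rule closure_minimal)
  then show ?thesis by (simp only: assms(1))
qed

text \<open>Volume sees a body only inside \<open>interior C\<close>, which fixes the form of the
  equality case. On a half-line volumes add up exactly, so equality always holds there.\<close>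

theorem theorem3:
  fixes C K\<^sub>1 K\<^sub>2 :: "(real ^ 'n) set" and l :: real
  assumes "closed C" and "convex_cone C" and "interior C \<noteq> {}" and "\<not> contains_line C"
    and "coconvex_body C K\<^sub>1" and "coconvex_body C K\<^sub>2"
    and "0 < l" and "l < 1"
  shows "let V = volume (coconvex_sum C ((*\<^sub>R) (1 - l) ` K\<^sub>1) ((*\<^sub>R) l ` K\<^sub>2));
             W = (1 - l) * volume K\<^sub>1 + l * volume K\<^sub>2
         in V \<le> W
          \<and> (K\<^sub>1 = K\<^sub>2 \<longrightarrow> V = W)
          \<and> (2 \<le> CARD('n) \<longrightarrow> (V = W \<longleftrightarrow> K\<^sub>1 \<inter> interior C = K\<^sub>2 \<inter> interior C))
          \<and> (2 \<le> CARD('n) \<and> K\<^sub>1 = closure (interior K\<^sub>1) \<and> K\<^sub>2 = closure (interior K\<^sub>2) \<longrightarrow>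
              (V = W \<longleftrightarrow> K\<^sub>1 = K\<^sub>2))"
proof -
  obtain v where v: "v \<in> interior C" "v \<noteq> 0"
  proof -
    have "interior C \<noteq> {0}"
    proof
      assume "interior C = {0}"
      with open_interior[of C] have "open {0 :: real ^ 'n}" by (simp only:)
      then show False using not_open_singleton by (rule notE[rotated])
    qed
    then obtain v where "v \<in> interior C" "v \<noteq> 0"
      using assms(3) by fast
    then show thesis by (rule that)
  qed
  have vC: "v \<in> C" using v interior_subset by blast
  have "- v \<notin> C"
  proof
    assume neg: "- v \<in> C"
    \<comment> \<open>Nonnegative multiples of \<open>v\<close> and \<open>- v\<close> together fill
      a line through the origin.\<close>
    have "0 + t *\<^sub>R v \<in> C" for t
      using convex_cone_scaleR[OF assms(2) _ vC, of t]
        convex_cone_scaleR[OF assms(2) _ neg, of "- t"] by (cases "0 \<le> t") auto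
    then have "contains_line C"
      unfolding contains_line_def by (intro exI[of _ 0] exI[of _ v] conjI allI v(2))
    then show False using assms(4) by simp
  qed
  then interpret cone_direction C v
    using assms v by unfold_locales
  note sum = assms(5-8)
  have regular: "K\<^sub>1 = K\<^sub>2"
    if "K\<^sub>1 = closure (interior K\<^sub>1)" "K\<^sub>2 = closure (interior K\<^sub>2)"
      "K\<^sub>1 \<inter> interior C = K\<^sub>2 \<inter> interior C"
    using regular_body_subset[of K\<^sub>1 K\<^sub>2 C] regular_body_subset[of K\<^sub>2 K\<^sub>1 C] that assms(5,6)
    by (auto simp: coconvex_body_def)
  have dim: "2 \<le> DIM(real ^ 'n)" if "2 \<le> CARD('n)" using that by simp
  let ?S = "sum_complement K\<^sub>1 K\<^sub>2 l" and ?W = "mean_volume K\<^sub>1 K\<^sub>2 l"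
  show ?thesis
    unfolding Let_def coconvex_sum_eq[OF sum] mean_volume_def[OF sum, symmetric]
  proof (intro conjI impI; (elim conjE)?)
    show "volume (C - ?S) \<le> ?W" by (rule volume_sum_le[OF sum])
    show "volume (C - ?S) = ?W" if "K\<^sub>1 = K\<^sub>2"
      using volume_sum_eq_if[OF sum] that by simp
    show iff: "volume (C - ?S) = ?W \<longleftrightarrow> K\<^sub>1 \<inter> interior C = K\<^sub>2 \<inter> interior C" if "2 \<le> CARD('n)"
      using volume_sum_eq_iff[OF sum dim[OF that]] depth_eq_iff[OF assms(5,6)] by simp
    show "volume (C - ?S) = ?W \<longleftrightarrow> K\<^sub>1 = K\<^sub>2"
      if "2 \<le> CARD('n)" "K\<^sub>1 = closure (interior K\<^sub>1)" "K\<^sub>2 = closure (interior K\<^sub>2)"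
      using iff[OF that(1)] regular[OF that(2,3)] by auto
  qed
qed

end
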